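(* For all integers $n\geq 0$ and $k\geq 3$, \begin{align*} \overline{R^\ast_{2^k}}(8n+1)&\equiv 0\pmod 2, & \overline{R^\ast_{2^k}}(8n+2)&\equiv 0\pmod 2,\\ \overline{R^\ast_{2^k}}(8n+3)&\equiv 0\pmod 4, & \overline{R^\ast_{2^k}}(8n+4)&\equiv 0\pmod 2,\\ \overline{R^\ast_{2^k}}(8n+5)&\equiv 0\pmod 8, & \overline{R^\ast_{2^k}}(8n+6)&\equiv 0\pmod 4,\\ \overline{R^\ast_{2^k}}(8n+7)&\equiv 0\pmod{16}. \end{align*}
   Context: An overpartition of $n$ is a partition of $n$ in which the first occurrence of each part size may optionally be overlined. For a positive integer $\ell$, $\overline{R_\ell^\ast}(n)$ denotes the number of overpartitions of $n$ in which no non-overlined part is divisible by $\ell$. Equivalently, with $f_k:=\prod_{i\geq 1}(1-q^{ki})$, one has $\sum_{n\geq 0}\overline{R_\ell^\ast}(n)q^n = \frac{f_2 f_\ell}{f_1^2}$. *)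

theory Defs
  imports "HOL-Library.Multiset" "HOL-Number_Theory.Cong"
begin

text \<open>
  An overpartition is a pair of the underlying partition, a multiset of positive parts, and
  the set of those part sizes whose first occurrence is overlined.
\<close>

definition overpartitions :: "nat \<Rightarrow> (nat multiset \<times> nat set) set" where
  "overpartitions n = {(P, S). 0 \<notin># P \<and> \<Sum>\<^sub># P = n \<and> S \<subseteq> set_mset P}"

text \<open>Overlining removes one occurrence of each size in \<open>S\<close> from the non-overlined parts.\<close>

definition nonoverlined_parts :: "nat multiset \<times> nat set \<Rightarrow> nat multiset" where
  "nonoverlined_parts \<pi> = fst \<pi> - mset_set (snd \<pi>)"

definition R_star :: "nat \<Rightarrow> nat \<Rightarrow> nat" where
  "R_star l n = card {\<pi> \<in> overpartitions n. \<forall>m \<in># nonoverlined_parts \<pi>. \<not> l dvd m}"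

text \<open>The set counted by \<^const>\<open>R_star\<close> is finite, so its cardinality is not a default value.\<close>

lemma finite_overpartitions: "finite (overpartitions n)"
proof -
  have size: "size P \<le> \<Sum>\<^sub># P" if "0 \<notin># P" for P :: "nat multiset"
    using that by (induction P) auto
  have "overpartitions n \<subseteq> (mset ` {xs. set xs \<subseteq> {..n} \<and> length xs \<le> n}) \<times> Pow {..n}"
  proof
    fix \<pi> assume "\<pi> \<in> overpartitions n"
    then obtain P S where \<pi>: "\<pi> = (P, S)" and P: "0 \<notin># P" "\<Sum>\<^sub># P = n" and S: "S \<subseteq> set_mset P"
      by (auto simp: overpartitions_def)
    have le: "set_mset P \<subseteq> {..n}"
      using P(2) by (auto dest!: multi_member_split)
    obtain xs where xs: "mset xs = P"
      using ex_mset by blast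
    have "set xs \<subseteq> {..n}" "length xs \<le> n"
      using xs le size[OF P(1)] P(2) by auto
    then show "\<pi> \<in> (mset ` {xs. set xs \<subseteq> {..n} \<and> length xs \<le> n}) \<times> Pow {..n}"
      using \<pi> xs S le by auto
  qed
  moreover have "finite ((mset ` {xs. set xs \<subseteq> {..n} \<and> length xs \<le> n}) \<times> Pow {..n})"
    by (intro finite_cartesian_product finite_imageI finite_lists_length_le) auto
  ultimately show ?thesis
    by (rule finite_subset)
qed

end

theory Submission
  imports Defs "HOL-Computational_Algebra.Formal_Power_Series"
begin

text \<open>
  By Gauss' identity, \<open>f\<^sub>1\<^sup>2 / f\<^sub>2 = 1 + 2 S\<close> with \<open>S\<close> the sum of \<open>(-1)\<^sup>s q ^ s\<^sup>2\<close> over \<open>s \<ge> 1\<close>.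
  The generating function \<open>F\<close> thus satisfies \<open>F (1 + 2 S) = f\<^sub>l\<close>, so
  \<open>F = f\<^sub>l (1 - 2 S + 4 S\<^sup>2 - 8 S\<^sup>3) + 16 S\<^sup>4 F\<close>. For \<open>8 dvd l\<close> the factor \<open>f\<^sub>l\<close> is a series in
  \<open>q\<^sup>8\<close>, and everything depends on which residues modulo 8 are sums of at most three positive squares.
  Splitting \<open>S = U + V\<close> into odd and even \<open>s\<close> shows that \<open>S\<^sup>2\<close> contributes to the residue 5 only
  through \<open>2 U V\<close>, whence the extra factor 2 there. All identities are used modulo \<open>q ^ Suc N\<close>
  with finite products.
\<close>

unbundle fps_syntax

text \<open>
  Shanks' finite form of Gauss' identity, with denominators cleared. The summand \<open>s = 0\<close> is the
  product of the \<open>1 - q\<^sup>i\<close>, and all others are divisible by \<open>q ^ Suc n\<close>. The product over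
  \<open>i < s\<close> includes \<open>i = 0\<close> and hence supplies the factor 2 that these other summands need.
\<close>

lemma gauss_square_finite:
  fixes q :: "'a :: comm_ring_1"
  shows "(\<Sum>s\<le>n. (- 1) ^ s * q ^ (s * Suc n) * (\<Prod>i<s. 1 + q ^ i) * (\<Prod>i=Suc s..n. 1 - q ^ i))
    = (\<Prod>i=1..n. 1 + q ^ i) * (1 + 2 * (\<Sum>s=1..n. (- 1) ^ s * q ^ s\<^sup>2))"
proof (induction n)
  case 0
  then show ?case by simp
next
  case (Suc n)
  define W where "W s = (\<Prod>i<s. 1 + q ^ i)" for s
  define t where "t m s = (- 1) ^ s * q ^ (s * Suc m) * W s * (\<Prod>i=Suc s..m. 1 - q ^ i)" for m s
  \<comment> \<open>\<open>v\<close> is a telescoping certificate: the recurrence in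
    \<open>n\<close> for the summands \<open>t\<close> leaves exactly a difference of
    \<open>v\<close> in \<open>s\<close>. Its product starts at \<open>i = s\<close>, one below that
    of \<open>t\<close>, so that \<open>v 0\<close> contains the factor
    \<open>1 - q ^ 0 = 0\<close>.\<close>
  define v where "v s = (- 1) ^ s * q ^ (s * Suc n) * W s * (\<Prod>i=s..n. 1 - q ^ i)" for s
  have W: "W (Suc n) = 2 * (\<Prod>i=1..n. 1 + q ^ i)" for n
    unfolding W_def by (induction n) (simp_all add: algebra_simps)
  have step: "t (Suc n) s - (1 + q ^ Suc n) * t n s = v (Suc s) - v s" if "s \<le> n" for s
  proof -
    define B where "B = (\<Prod>i=Suc s..n. 1 - q ^ i)"
    have B: "(\<Prod>i=s..n. 1 - q ^ i) = (1 - q ^ s) * B"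
      using that by (simp add: B_def prod.atLeast_Suc_atMost)
    have B': "(\<Prod>i=Suc s..Suc n. 1 - q ^ i) = B * (1 - q ^ Suc n)"
      using that by (simp add: B_def)
    have W': "W (Suc s) = W s * (1 + q ^ s)"
      by (simp add: W_def)
    have q: "q ^ (s * Suc (Suc n)) = q ^ (s * Suc n) * q ^ s"
      "q ^ (Suc s * Suc n) = q ^ (s * Suc n) * q ^ Suc n"
      by (simp_all add: algebra_simps power_add)
    show ?thesis
      unfolding t_def v_def B B' W' q B_def[symmetric] power_Suc[of "-1" s]
      by (simp only: mult_minus_left mult_minus_right mult_1_left mult_1_right
          minus_add_distrib algebra_simps) simp
  qed
  have "(\<Sum>s\<le>n. t (Suc n) s) - (1 + q ^ Suc n) * (\<Sum>s\<le>n. t n s) = (\<Sum>s\<le>n. v (Suc s) - v s)"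
    by (simp only: sum_distrib_left flip: sum_subtractf) (simp add: step del: power_Suc)
  also have "\<dots> = v (Suc n) - v 0"
    using sum_lessThan_telescope[of v "Suc n"] by (simp only: lessThan_Suc_atMost)
  also have "v 0 = 0"
    by (simp add: v_def prod.atLeast_Suc_atMost)
  finally have "(\<Sum>s\<le>Suc n. t (Suc n) s)
      = (1 + q ^ Suc n) * (\<Sum>s\<le>n. t n s) + (v (Suc n) + t (Suc n) (Suc n))"
    by (simp add: algebra_simps)
  \<comment> \<open>Both products over \<open>i\<close> are empty here. The two exponents differ by
    \<open>Suc n\<close>, which gives the factor \<open>1 + q ^ Suc n\<close>, and the sum is the
    new square term of the right-hand side.\<close>
  also have "v (Suc n) + t (Suc n) (Suc n)
      = 2 * (- 1) ^ Suc n * q ^ (Suc n)\<^sup>2 * ((1 + q ^ Suc n) * (\<Prod>i=1..n. 1 + q ^ i))"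
  proof -
    have "q ^ (Suc n * Suc (Suc n)) = q ^ (Suc n)\<^sup>2 * q ^ Suc n" "q ^ (Suc n * Suc n) = q ^ (Suc n)\<^sup>2"
      by (simp_all add: power2_eq_square algebra_simps power_add)
    then show ?thesis
      unfolding v_def t_def W by (simp only:) (simp add: algebra_simps)
  qed
  finally show ?case
    unfolding t_def W_def by (simp only: Suc.IH) (simp add: algebra_simps)
qed

section \<open>Overpartitions and their generating function\<close>

definition bounded_partitions :: "nat set \<Rightarrow> nat \<Rightarrow> nat multiset set" where
  "bounded_partitions A n = {Q. set_mset Q \<subseteq> A \<and> \<Sum>\<^sub># Q = n}"

text \<open>For \<open>0 \<in> A\<close> every nonempty set of such partitions is infinite and
  \<open>card\<close> returns 0; hence the hypotheses \<open>0 \<notin> A\<close> below.\<close>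

definition partition_fps :: "nat set \<Rightarrow> int fps" where
  "partition_fps A = Abs_fps (\<lambda>n. int (card (bounded_partitions A n)))"

lemma finite_bounded_partitions:
  assumes "0 \<notin> A"
  shows "finite (bounded_partitions A n)"
proof (rule finite_subset)
  show "bounded_partitions A n \<subseteq> fst ` overpartitions n"
    using assms by (force simp: bounded_partitions_def overpartitions_def)
  show "finite (fst ` overpartitions n)"
    by (simp add: finite_overpartitions)
qed

text \<open>If \<open>a\<close> occurs, one copy is removed and the rest may still contain
  \<open>a\<close>. This recursion produces the geometric factor
  \<open>1 / (1 - q ^ a)\<close>.\<close>

lemma bounded_partitions_insert:
  "bounded_partitions (insert a A) n = bounded_partitions A n \<union>
    (if a \<le> n then add_mset a ` bounded_partitions (insert a A) (n - a) else {})"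
  (is "?L = ?R")
proof
  show "?L \<subseteq> ?R"
  proof
    fix Q assume Q: "Q \<in> ?L"
    show "Q \<in> ?R"
    proof (cases "a \<in># Q")
      case True
      then obtain P where P: "Q = add_mset a P"
        by (auto dest: multi_member_split)
      then have "a \<le> n" "P \<in> bounded_partitions (insert a A) (n - a)"
        using Q by (auto simp: bounded_partitions_def)
      then show ?thesis
        using P by auto
    next
      case False
      then show ?thesis
        using Q by (auto simp: bounded_partitions_def)
    qed
  qed
  show "?R \<subseteq> ?L"
    by (auto simp: bounded_partitions_def split: if_splits)
qed

lemma partition_fps_insert:
  assumes "a \<notin> A" "0 \<notin> insert a A"
  shows "partition_fps (insert a A) * (1 - fps_X ^ a) = partition_fps A"
proof (rule fps_ext)
  fix n
  have "card (bounded_partitions (insert a A) n) = card (bounded_partitions A n) +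
      (if a \<le> n then card (bounded_partitions (insert a A) (n - a)) else 0)"
  proof -
    have "card (bounded_partitions (insert a A) n) = card (bounded_partitions A n) +
        card (if a \<le> n then add_mset a ` bounded_partitions (insert a A) (n - a) else {})"
      using assms
      by (subst bounded_partitions_insert, subst card_Un_disjoint)
        (auto simp: finite_bounded_partitions, auto simp: bounded_partitions_def)
    then show ?thesis
      by (auto simp: card_image inj_on_def)
  qed
  then show "(partition_fps (insert a A) * (1 - fps_X ^ a)) $ n = partition_fps A $ n"
    by (simp add: partition_fps_def right_diff_distrib fps_X_power_mult_right_nth)
qed

lemma partition_fps_mult_prod:
  assumes "finite A" "0 \<notin> A"
  shows "partition_fps A * (\<Prod>i\<in>A. 1 - fps_X ^ i) = 1"
  using assms
proof (induction A rule: finite_induct)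
  case empty
  have "bounded_partitions {} n = (if n = 0 then {{#}} else {})" for n
    by (auto simp: bounded_partitions_def)
  then show ?case
    by (simp add: partition_fps_def fps_eq_iff)
next
  case (insert a A)
  then show ?case
    by (simp add: partition_fps_insert flip: mult.assoc)
qed

text \<open>Expanding the product chooses \<open>fps_X ^ i\<close> or 1 from each factor, hence a
  subset of \<open>A\<close>. The subsets serve as sets of overlined sizes.\<close>

lemma distinct_partitions_nth:
  assumes "finite A"
  shows "(\<Prod>i\<in>A. 1 + fps_X ^ i :: int fps) $ n = int (card {S. S \<subseteq> A \<and> \<Sum>S = n})"
proof -
  have "(\<Prod>i\<in>A. 1 + fps_X ^ i :: int fps) = (\<Prod>i\<in>A. fps_X ^ i + 1)"
    by (simp add: add.commute)
  also have "\<dots> = (\<Sum>S\<in>Pow A. fps_X ^ \<Sum>S)"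
    using assms by (simp add: prod_add power_sum)
  finally have "(\<Prod>i\<in>A. 1 + fps_X ^ i :: int fps) $ n = (\<Sum>S\<in>Pow A. if n = \<Sum>S then 1 else 0)"
    by (simp add: fps_sum_nth)
  also have "\<dots> = int (card {S \<in> Pow A. n = \<Sum>S})"
    using assms by (simp add: sum.If_cases Int_def)
  also have "{S \<in> Pow A. n = \<Sum>S} = {S. S \<subseteq> A \<and> \<Sum>S = n}"
    by auto
  finally show ?thesis .
qed

text \<open>The non-overlined parts \<open>Q\<close> and the overlined sizes \<open>S\<close> can be
  chosen independently, so the count is a Cauchy product. No part exceeds \<open>n\<close>, which
  makes factors up to \<open>N\<close> sufficient.\<close>

lemma R_star_eq_nth:
  assumes "n \<le> N"
  shows "int (R_star l n) =
    (partition_fps {i \<in> {1..N}. \<not> l dvd i} * (\<Prod>i=1..N. 1 + fps_X ^ i)) $ n"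
proof -
  let ?A = "{i \<in> {1..N}. \<not> l dvd i}"
  let ?S = "\<lambda>m. {S. S \<subseteq> {1..N} \<and> \<Sum>S = m}"
  let ?T = "\<Union>j\<in>{..n}. bounded_partitions ?A j \<times> ?S (n - j)"
  let ?R = "{\<pi> \<in> overpartitions n. \<forall>m \<in># nonoverlined_parts \<pi>. \<not> l dvd m}"
  have sum_mset_set: "\<Sum>\<^sub># (mset_set S) = \<Sum>S" for S :: "nat set"
    using sum_unfold_sum_mset[of "\<lambda>x. x" S] by simp
  have bij: "bij_betw (\<lambda>(Q, S). (Q + mset_set S, S)) ?T ?R"
  proof (rule bij_betw_byWitness[where f' = "\<lambda>\<pi>. (nonoverlined_parts \<pi>, snd \<pi>)"])
    show "\<forall>\<tau>\<in>?T. (\<lambda>\<pi>. (nonoverlined_parts \<pi>, snd \<pi>)) (case \<tau> of (Q, S) \<Rightarrow> (Q + mset_set S, S)) = \<tau>"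
      by (auto simp: nonoverlined_parts_def)
    \<comment> \<open>Multiset difference truncates; this inclusion ensures that adding
      \<open>mset_set S\<close> back recovers \<open>P\<close>.\<close>
    have sub: "mset_set S \<subseteq># P" if "S \<subseteq> set_mset P" for S and P :: "nat multiset"
      using subset_imp_msubset_mset_set[OF that] mset_set_set_mset_msubset[of P]
      by (auto intro: subset_mset.order_trans)
    show "\<forall>\<pi>\<in>?R. (case (nonoverlined_parts \<pi>, snd \<pi>) of (Q, S) \<Rightarrow> (Q + mset_set S, S)) = \<pi>"
      using sub by (auto simp: nonoverlined_parts_def overpartitions_def)
    \<comment> \<open>\<open>mset_set\<close> of an infinite set is empty, so finiteness of
      \<open>S\<close> matters.\<close>
    have mset_set: "set_mset (mset_set S) = S" if "S \<subseteq> {1..N}" for S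
      using that by (auto dest: finite_subset)
    have "0 \<notin> S" if "S \<subseteq> {1..N}" for S
      using that by auto
    moreover have "0 \<notin># Q" if "set_mset Q \<subseteq> ?A" for Q
      using that by auto
    ultimately show "(\<lambda>(Q, S). (Q + mset_set S, S)) ` ?T \<subseteq> ?R"
      by (auto simp: nonoverlined_parts_def overpartitions_def bounded_partitions_def
          sum_mset_set mset_set)
    show "(\<lambda>\<pi>. (nonoverlined_parts \<pi>, snd \<pi>)) ` ?R \<subseteq> ?T"
    proof safe
      fix P S
      assume PS: "(P, S) \<in> overpartitions n"
        and l: "\<forall>m \<in># nonoverlined_parts (P, S). \<not> l dvd m"
      define Q where "Q = nonoverlined_parts (P, S)"
      have S: "S \<subseteq> set_mset P"
        using PS by (auto simp: overpartitions_def)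
      have P: "P = Q + mset_set S"
        using sub[OF S] by (simp add: Q_def nonoverlined_parts_def)
      have n: "\<Sum>\<^sub># Q + \<Sum>S = n" and "0 \<notin># P"
        using PS by (auto simp: overpartitions_def P sum_mset_set)
      then have "set_mset P \<subseteq> {1..N}"
        using PS assms by (auto simp: overpartitions_def Suc_le_eq dest!: multi_member_split intro!: Nat.gr0I)
      then have "Q \<in> bounded_partitions ?A (\<Sum>\<^sub># Q)" "S \<in> ?S (n - \<Sum>\<^sub># Q)"
        using S l[folded Q_def] n by (auto simp: bounded_partitions_def P)
      then show "(nonoverlined_parts (P, S), snd (P, S)) \<in> ?T"
        using n by (auto simp flip: Q_def)
    qed
  qed
  have "R_star l n = card ?T"
    unfolding R_star_def using bij_betw_same_card[OF bij] by simp
  also have "\<dots> = (\<Sum>j\<le>n. card (bounded_partitions ?A j) * card (?S (n - j)))"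
  proof (subst card_UN_disjoint)
    show "\<forall>j\<in>{..n}. finite (bounded_partitions ?A j \<times> ?S (n - j))"
      by (simp add: finite_bounded_partitions)
    show "\<forall>i\<in>{..n}. \<forall>j\<in>{..n}. i \<noteq> j \<longrightarrow>
        (bounded_partitions ?A i \<times> ?S (n - i)) \<inter> (bounded_partitions ?A j \<times> ?S (n - j)) = {}"
      by (auto simp: bounded_partitions_def)
  qed (simp_all add: card_cartesian_product)
  finally show ?thesis
    by (simp add: fps_mult_nth distinct_partitions_nth partition_fps_def atLeast0AtMost)
qed

section \<open>Truncated cancellation and supports modulo 8\<close>

text \<open>Over an integral domain, a factor with nonzero constant term does not change the
  subdegree. This replaces division by \<open>D\<close>.\<close>

lemma fps_nth_eq_0_if_unit_mult:
  fixes D Y :: "'a :: idom fps"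
  assumes "D * Y = fps_X ^ Suc N * C" "D $ 0 \<noteq> 0" "m \<le> N"
  shows "Y $ m = 0"
proof (cases "Y = 0")
  case False
  have "D \<noteq> 0" "subdegree D = 0"
    using assms(2) by auto
  then have "D * Y \<noteq> 0" "subdegree (D * Y) = subdegree Y"
    using False by auto
  moreover have "subdegree (fps_X ^ Suc N * C) \<ge> Suc N"
    using calculation assms(1) by (intro subdegree_geI) (auto simp: fps_X_power_mult_nth simp del: power_Suc)
  ultimately have "m < subdegree Y"
    using assms by simp
  then show ?thesis
    by (rule nth_less_subdegree_zero)
qed simp

definition supported_mod8 :: "int fps \<Rightarrow> nat set \<Rightarrow> bool" where
  "supported_mod8 f I \<longleftrightarrow> (\<forall>m. f $ m \<noteq> 0 \<longrightarrow> m mod 8 \<in> I)"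

lemma supported_mod8_nth: "supported_mod8 f I \<Longrightarrow> m mod 8 \<notin> I \<Longrightarrow> f $ m = 0"
  by (auto simp: supported_mod8_def)

lemma supported_mod8_mult:
  assumes "supported_mod8 f I" "supported_mod8 g J"
  shows "supported_mod8 (f * g) ((\<lambda>(i, j). (i + j) mod 8) ` (I \<times> J))"
  unfolding supported_mod8_def
proof safe
  fix m assume "(f * g) $ m \<noteq> 0"
  then obtain i where i: "i \<le> m" "f $ i \<noteq> 0" "g $ (m - i) \<noteq> 0"
    by (auto simp: fps_mult_nth elim!: sum.not_neutral_contains_not_neutral)
  then have "i mod 8 \<in> I" "(m - i) mod 8 \<in> J"
    using assms by (auto simp: supported_mod8_def)
  moreover have "m mod 8 = (i mod 8 + (m - i) mod 8) mod 8"
    using i(1) by (simp add: mod_add_eq)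
  ultimately show "m mod 8 \<in> (\<lambda>(i, j). (i + j) mod 8) ` (I \<times> J)"
    by force
qed

lemma supported_mod8_1: "supported_mod8 1 {0}"
  by (simp add: supported_mod8_def)

lemma supported_mod8_prod:
  assumes "\<And>i. i \<in> A \<Longrightarrow> supported_mod8 (f i) {0}"
  shows "supported_mod8 (\<Prod>i\<in>A. f i) {0}"
  using assms
proof (induction A rule: infinite_finite_induct)
  case (insert a A)
  then show ?case
    using supported_mod8_mult[of "f a" "{0}" "\<Prod>i\<in>A. f i" "{0}"] by simp
qed (simp_all add: supported_mod8_1)

lemma supported_mod8_sum_squares:
  assumes "\<And>s. s \<in> A \<Longrightarrow> s\<^sup>2 mod 8 \<in> I"
  shows "supported_mod8 (\<Sum>s\<in>A. (- 1) ^ s * fps_X ^ s\<^sup>2) I"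
  unfolding supported_mod8_def
proof safe
  fix m assume "(\<Sum>s\<in>A. (- 1) ^ s * fps_X ^ s\<^sup>2 :: int fps) $ m \<noteq> 0"
  then have "\<exists>s\<in>A. ((- 1) ^ s * fps_X ^ s\<^sup>2 :: int fps) $ m \<noteq> 0"
    by (auto simp: fps_sum_nth elim!: sum.not_neutral_contains_not_neutral)
  then obtain s where "s \<in> A" "m = s\<^sup>2"
    by (auto simp: fps_X_power_mult_right_nth minus_one_power_iff split: if_splits)
  then show "m mod 8 \<in> I"
    using assms by simp
qed

lemma square_mod8: "s\<^sup>2 mod 8 = (if odd s then 1 else if 4 dvd s then 0 else 4)" for s :: nat
proof -
  have "s mod 8 \<in> {0, 1, 2, 3, 4, 5, 6, 7}"
    by (simp, presburger)
  moreover have "s\<^sup>2 mod 8 = (s mod 8)\<^sup>2 mod 8"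
    by (simp add: power_mod)
  moreover have "odd s \<longleftrightarrow> odd (s mod 8)" "4 dvd s \<longleftrightarrow> 4 dvd s mod 8"
    by presburger+
  ultimately show ?thesis
    by auto
qed

section \<open>Expansion of the generating function and the congruences\<close>

text \<open>\<open>F\<close> is \<open>P * D\<close>. Modulo \<open>q ^ Suc N\<close>, Gauss'
  identity turns \<open>D * \<theta>\<close> into \<open>E\<close>, and \<open>P\<close> cancels all
  factors of \<open>E\<close> except those with \<open>l dvd i\<close>, whose product is
  \<open>L\<close>.\<close>

lemma R_star_mult_theta:
  assumes "8 dvd l"
  obtains F L :: "int fps" where "F $ N = int (R_star l N)" "supported_mod8 L {0}"
    "\<And>m. m \<le> N \<Longrightarrow> (F * (1 + 2 * (\<Sum>s=1..N. (- 1) ^ s * fps_X ^ s\<^sup>2)) - L) $ m = 0"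
proof -
  let ?A = "{i \<in> {1..N}. \<not> l dvd i}"
  let ?B = "{i \<in> {1..N}. l dvd i}"
  define D :: "int fps" where "D = (\<Prod>i=1..N. 1 + fps_X ^ i)"
  define L :: "int fps" where "L = (\<Prod>i\<in>?B. 1 - fps_X ^ i)"
  define \<theta> :: "int fps" where "\<theta> = 1 + 2 * (\<Sum>s=1..N. (- 1) ^ s * fps_X ^ s\<^sup>2)"
  have D0: "D $ 0 = 1"
    unfolding D_def by (induction N) simp_all
  define P where "P = partition_fps ?A"
  define E :: "int fps" where "E = (\<Prod>i=1..N. 1 - fps_X ^ i)"
  have E: "E = (\<Prod>i\<in>?A. 1 - fps_X ^ i) * L"
    unfolding E_def L_def
    by (subst prod.union_disjoint[symmetric]) (auto intro!: prod.cong)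
  have PE: "P * E = L"
    using partition_fps_mult_prod[of ?A] by (simp add: P_def E flip: mult.assoc)
  \<comment> \<open>\<open>C\<close> collects the summands \<open>s \<ge> 1\<close> of the finite
    identity after \<open>fps_X ^ Suc N\<close> is taken out, whence the exponent
    \<open>s - 1\<close>.\<close>
  define C :: "int fps" where "C = (\<Sum>s=1..N. (- 1) ^ s * fps_X ^ ((s - 1) * Suc N) *
      (\<Prod>i<s. 1 + fps_X ^ i) * (\<Prod>i=Suc s..N. 1 - fps_X ^ i))"
  have "D * \<theta> = E + fps_X ^ Suc N * C"
  proof -
    have exponent: "fps_X ^ (s * Suc N) = fps_X ^ Suc N * (fps_X ^ ((s - 1) * Suc N) :: int fps)" if "s \<ge> 1" for s
      using that by (cases s) (simp_all add: power_add)
    have "{..N} = insert 0 {1..N}"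
      by auto
    then have "D * \<theta> = E + (\<Sum>s=1..N. (- 1) ^ s * fps_X ^ (s * Suc N) *
        (\<Prod>i<s. 1 + fps_X ^ i) * (\<Prod>i=Suc s..N. 1 - fps_X ^ i))"
      unfolding D_def E_def \<theta>_def gauss_square_finite[symmetric] by simp
    also have "(\<Sum>s=1..N. (- 1) ^ s * fps_X ^ (s * Suc N) *
        (\<Prod>i<s. 1 + fps_X ^ i) * (\<Prod>i=Suc s..N. 1 - fps_X ^ i)) = fps_X ^ Suc N * C"
      unfolding C_def sum_distrib_left
      by (intro sum.cong refl, subst exponent) (simp_all only: atLeastAtMost_iff mult_ac)
    finally show ?thesis .
  qed
  \<comment> \<open>The extra factor \<open>D\<close> makes \<open>D * \<theta>\<close> appear, to
    which the finite identity applies; it is cancelled afterwards.\<close>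
  moreover have "D * (P * D * \<theta> - L) = P * D * (D * \<theta>) - D * L"
    by (simp add: algebra_simps)
  ultimately have "D * (P * D * \<theta> - L) = P * D * (E + fps_X ^ Suc N * C) - D * L"
    by simp
  also have "\<dots> = fps_X ^ Suc N * (P * D * C)"
    unfolding PE[symmetric] by (simp only: algebra_simps)
  finally have eq: "D * (P * D * \<theta> - L) = fps_X ^ Suc N * (P * D * C)" .
  have "(P * D * \<theta> - L) $ m = 0" if "m \<le> N" for m
    using eq _ that by (rule fps_nth_eq_0_if_unit_mult) (simp add: D0)
  moreover have "(P * D) $ N = int (R_star l N)"
    unfolding P_def D_def by (rule R_star_eq_nth[symmetric]) simp
  moreover have "supported_mod8 L {0}"
    unfolding L_def
  proof (rule supported_mod8_prod)
    fix i assume "i \<in> ?B"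
    then have "8 dvd i"
      using assms dvd_trans by blast
    then show "supported_mod8 (1 - fps_X ^ i) {0}"
      by (auto simp: supported_mod8_def split: if_splits)
  qed
  ultimately show thesis
    using that unfolding \<theta>_def by blast
qed

lemma R_star_expansion:
  assumes "8 dvd l"
  obtains L U V G :: "int fps"
  where "supported_mod8 L {0}" "supported_mod8 U {1}" "supported_mod8 V {0, 4}"
    "int (R_star l N) = (L * (1 - 2 * (U + V) + 4 * (U + V)\<^sup>2 - 8 * (U + V) ^ 3) + 16 * G) $ N"
proof -
  obtain F L where F: "F $ N = int (R_star l N)" and L: "supported_mod8 L {0}"
    and eq: "\<And>m. m \<le> N \<Longrightarrow> (F * (1 + 2 * (\<Sum>s=1..N. (- 1) ^ s * fps_X ^ s\<^sup>2)) - L) $ m = 0"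
    using R_star_mult_theta[OF assms, of N] by blast
  define U :: "int fps" where "U = (\<Sum>s\<in>{s \<in> {1..N}. odd s}. (- 1) ^ s * fps_X ^ s\<^sup>2)"
  define V :: "int fps" where "V = (\<Sum>s\<in>{s \<in> {1..N}. even s}. (- 1) ^ s * fps_X ^ s\<^sup>2)"
  define S where "S = U + V"
  have S: "(\<Sum>s=1..N. (- 1) ^ s * fps_X ^ s\<^sup>2) = S"
    unfolding S_def U_def V_def
    by (subst sum.union_disjoint[symmetric]) (auto intro!: sum.cong)
  define Y where "Y = F * (1 + 2 * S) - L"
  define T where "T = 1 - 2 * S + 4 * S\<^sup>2 - 8 * S ^ 3"
  \<comment> \<open>\<open>T\<close> is the truncated geometric series, with
    \<open>T * (1 + 2 * S) = 1 - 16 * S ^ 4\<close>. The error \<open>Y\<close> vanishes up to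
    degree \<open>N\<close>, and so does \<open>Y * T\<close>.\<close>
  have "F = L * T + 16 * (F * S ^ 4) + Y * T"
    unfolding T_def Y_def by (simp add: algebra_simps power2_eq_square power3_eq_cube power4_eq_xxxx)
  moreover have "(Y * T) $ N = 0"
    unfolding fps_mult_nth using eq[unfolded S, folded Y_def] by (intro sum.neutral) simp
  ultimately have "int (R_star l N) = (L * T + 16 * (F * S ^ 4)) $ N"
    by (metis F fps_add_nth add.right_neutral)
  moreover have "supported_mod8 U {1}" "supported_mod8 V {0, 4}"
    unfolding U_def V_def by (rule supported_mod8_sum_squares, simp add: square_mod8)+
  ultimately show thesis
    using that L unfolding T_def S_def by blast
qed

theorem theorem1p7:
  fixes n k :: nat
  assumes "k \<ge> 3"
  shows "[R_star (2 ^ k) (8 * n + 1) = 0] (mod 2) \<and>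
         [R_star (2 ^ k) (8 * n + 2) = 0] (mod 2) \<and>
         [R_star (2 ^ k) (8 * n + 3) = 0] (mod 4) \<and>
         [R_star (2 ^ k) (8 * n + 4) = 0] (mod 2) \<and>
         [R_star (2 ^ k) (8 * n + 5) = 0] (mod 8) \<and>
         [R_star (2 ^ k) (8 * n + 6) = 0] (mod 4) \<and>
         [R_star (2 ^ k) (8 * n + 7) = 0] (mod 16)"
proof -
  have "(2 :: nat) ^ 3 dvd 2 ^ k"
    using assms by (rule le_imp_power_dvd)
  then have "8 dvd (2 :: nat) ^ k"
    by simp
  have *: "[R_star (2 ^ k) N = 0] (mod (if N mod 8 = 7 then 16 else if N mod 8 = 5 then 8
      else if N mod 8 \<in> {3, 6} then 4 else 2))" if "N mod 8 \<noteq> 0" for N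
  proof -
    obtain L U V G :: "int fps" where
      L: "supported_mod8 L {0}" and U: "supported_mod8 U {1}" and V: "supported_mod8 V {0, 4}" and
      R: "int (R_star (2 ^ k) N) = (L * (1 - 2 * (U + V) + 4 * (U + V)\<^sup>2 - 8 * (U + V) ^ 3) + 16 * G) $ N"
      using R_star_expansion[OF \<open>8 dvd 2 ^ k\<close>, of N] by blast
    note mult = supported_mod8_mult
    note LU = mult[OF L U] and LV = mult[OF L V]
    note LUU = mult[OF LU U] and LVV = mult[OF LV V]
    \<comment> \<open>Residue 7 lies in none of these supports. Residues 3, 5 and 6 occur only in
      products whose coefficient below is a multiple of 8, and residues 1, 2 and 4 do not occur in
      \<open>L\<close>.\<close>
    note supports = L LU LV LUU LVV mult[OF LU V] mult[OF LUU U] mult[OF LUU V] mult[OF LVV U] mult[OF LVV V]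
    note zeros = supports[THEN supported_mod8_nth, of N]
    \<comment> \<open>The monomials are bracketed as in \<open>supports\<close>. The mixed term of
      the square gets coefficient 8 instead of 4, which gives residue 5 its modulus.\<close>
    have "L * (1 - 2 * (U + V) + 4 * (U + V)\<^sup>2 - 8 * (U + V) ^ 3) + 16 * G =
        L - 2 * (L * U + L * V) + 4 * (L * U * U + L * V * V) + 8 * (L * U * V)
        - 8 * (L * U * U * U + 3 * (L * U * U * V) + 3 * (L * V * V * U) + L * V * V * V) + 16 * G"
      by (simp add: algebra_simps power2_eq_square power3_eq_cube)
    then have R': "int (R_star (2 ^ k) N) = L $ N - 2 * ((L * U) $ N + (L * V) $ N)
        + 4 * ((L * U * U) $ N + (L * V * V) $ N) + 8 * (L * U * V) $ N
        - 8 * ((L * U * U * U) $ N + 3 * (L * U * U * V) $ N + 3 * (L * V * V * U) $ N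
          + (L * V * V * V) $ N) + 16 * G $ N"
      unfolding R by (simp add: numeral_fps_const)
    have "N mod 8 \<in> {1, 2, 3, 4, 5, 6, 7}"
      using that by (simp, presburger)
    then have "int (if N mod 8 = 7 then 16 else if N mod 8 = 5 then 8
        else if N mod 8 \<in> {3, 6} then 4 else 2) dvd int (R_star (2 ^ k) N)"
      using zeros R' by (auto intro!: dvd_add dvd_diff dvd_mult2)
    then show ?thesis
      by (simp only: cong_0_iff int_dvd_int_iff)
  qed
  show ?thesis
    using *[of "8 * n + 1"] *[of "8 * n + 2"] *[of "8 * n + 3"] *[of "8 * n + 4"]
      *[of "8 * n + 5"] *[of "8 * n + 6"] *[of "8 * n + 7"]
    by (simp del: add_2_eq_Suc')
qed
end
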